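(* Let $T:X\to X$ be a power-bounded operator on a complex reflexive Banach space $X$. Then $$\overline{\operatorname{span}(\mathcal{E}(T))}=\overline{\operatorname{URec}(T)}.$$ In particular: (a) The following statements are equivalent: (i) $\mathcal{E}(T)\neq\varnothing$; (ii) $\Delta^*\mathrm{Rec}(T)\setminus\{0\}\neq\varnothing$; (iii) $\mathcal{IP}^*\mathrm{Rec}(T)\setminus\{0\}\neq\varnothing$; (iv) $\operatorname{URec}(T)\setminus\{0\}\neq\varnothing$. (b) The following statements are equivalent: (i) the set $\operatorname{span}(\mathcal{E}(T))$ is dense in $X$; (ii) $T$ is $\Delta^*$-recurrent; (iii) $T$ is $\mathcal{IP}^*$-recurrent; (iv) $T$ is uniformly recurrent.
   Context: $\mathbb{N}=\{1,2,\dots\}$, $\mathbb{N}_0=\mathbb{N}\cup\{0\}$, $\mathbb{T}=\{z\in\mathbb{C}:|z|=1\}$. Power-bounded means $T$ is a bounded linear operator with $\sup_{n\ge0}\|T^n\|<\infty$. The set of unimodular eigenvectors is $\mathcal{E}(T)=\bigcup_{\lambda\in\mathbb{T}}\ker(\lambda-T)\setminus\{0\}$ (and $\operatorname{span}(\varnothing)=\{0\}$). $N(x,A)=\{n\in\mathbb{N}_0:T^nx\in A\}$. Closures, density and neighbourhoods are for the norm topology. Families of subsets of $\mathbb{N}_0$: $A$ is syndetic if there is $m\in\mathbb{N}$ such that $[x,x+m]\cap A\ne\varnothing$ for every $x\in\mathbb{N}_0$. $A$ is an IP-set if there is a (strictly) increasing sequence $(x_n)_{n\ge1}$ in $\mathbb{N}_0$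 with $\{\sum_{n\in F}x_n: F\subset\mathbb{N}\text{ finite non-empty}\}\subset A$. $A$ is a $\Delta$-set if there is an infinite $B\subset\mathbb{N}_0$ with $(B-B)\cap\mathbb{N}\subset A$. $\mathcal{IP}$ and $\Delta$ denote the families of IP-sets and $\Delta$-sets. The dual family of $\mathcal{F}$ is $\mathcal{F}^*=\{A\subset\mathbb{N}_0\text{ infinite}: A\cap B\neq\varnothing\text{ for all }B\in\mathcal{F}\}$. $\operatorname{URec}(T)$ (resp. $\mathcal{IP}^*\mathrm{Rec}(T)$, $\Delta^*\mathrm{Rec}(T)$) is the set of $x\in X$ such that for every neighbourhood $U$ of $x$ the set $N(x,U)$ is syndetic (resp. belongs to $\mathcal{IP}^*$, to $\Delta^*$). $T$ is uniformly (resp. $\mathcal{IP}^*$-, $\Delta^*$-) recurrent if the corresponding set is dense in $X$. *)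

theory Defs
  imports "HOL-Analysis.Analysis"
begin

section \<open>Complex Banach spaces\<close>

text \<open>Compatibility of the two scalar multiplications (\<open>scaleC_of_real\<close>) makes the underlying real
  normed space, and hence the library's topology, the expected one.\<close>

class complex_normed_vector = real_normed_vector +
  fixes scaleC :: "complex \<Rightarrow> 'a \<Rightarrow> 'a"  (infixr \<open>*\<^sub>C\<close> 75)
  assumes scaleC_add_right: "a *\<^sub>C (x + y) = a *\<^sub>C x + a *\<^sub>C y"
    and scaleC_add_left: "(a + b) *\<^sub>C x = a *\<^sub>C x + b *\<^sub>C x"
    and scaleC_scaleC: "a *\<^sub>C b *\<^sub>C x = (a * b) *\<^sub>C x"
    and scaleC_of_real: "complex_of_real r *\<^sub>C x = r *\<^sub>R x"
    and norm_scaleC: "norm (a *\<^sub>C x) = cmod a * norm x"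

class complex_banach = complex_normed_vector + banach

instantiation complex :: complex_banach
begin

definition scaleC_complex :: "complex \<Rightarrow> complex \<Rightarrow> complex" where
  "scaleC_complex a x = a * x"

instance
  by standard (simp_all add: scaleC_complex_def algebra_simps scaleR_conv_of_real norm_mult)

end

global_interpretation complex_vector:
  vector_space "scaleC :: complex \<Rightarrow> 'a \<Rightarrow> 'a::complex_normed_vector"
  defines cspan = complex_vector.span
proof
  fix x :: 'a
  show "1 *\<^sub>C x = x"
    using scaleC_of_real [of 1 x] by simp
qed (simp_all add: scaleC_add_right scaleC_add_left scaleC_scaleC)

definition bounded_clinear :: "('a::complex_normed_vector \<Rightarrow> 'b::complex_normed_vector) \<Rightarrow> bool" where
  "bounded_clinear f \<longleftrightarrow> bounded_linear f \<and> (\<forall>c x. f (c *\<^sub>C x) = c *\<^sub>C f x)"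

text \<open>The dual carries the norm \<^const>\<open>onorm\<close>. For a complex-linear functional this real operator
  norm is the usual one, since it is the supremum of the same quotients.\<close>

definition cdual :: "('a::complex_normed_vector \<Rightarrow> complex) set" where
  "cdual = {f. bounded_clinear f}"

text \<open>Elements of the bidual are represented by functionals of which only the values on \<open>cdual\<close>
  matter.\<close>

definition cbidual :: "(('a::complex_normed_vector \<Rightarrow> complex) \<Rightarrow> complex) set" where
  "cbidual = {\<phi>.
     (\<forall>f\<in>cdual. \<forall>g\<in>cdual. \<phi> (\<lambda>x. f x + g x) = \<phi> f + \<phi> g) \<and>
     (\<forall>c. \<forall>f\<in>cdual. \<phi> (\<lambda>x. c * f x) = c * \<phi> f) \<and>
     (\<exists>K. \<forall>f\<in>cdual. cmod (\<phi> f) \<le> K * onorm f)}"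

text \<open>Reflexivity: the canonical embedding into the bidual is surjective.\<close>

definition reflexive_space :: "'a::complex_normed_vector itself \<Rightarrow> bool" where
  "reflexive_space _ \<longleftrightarrow> (\<forall>\<phi>\<in>cbidual. \<exists>x::'a. \<forall>f\<in>cdual. \<phi> f = f x)"


section \<open>Operators\<close>

definition power_bounded :: "('a::complex_normed_vector \<Rightarrow> 'a) \<Rightarrow> bool" where
  "power_bounded T \<longleftrightarrow> bounded_clinear T \<and> bdd_above (range (\<lambda>n. onorm (T ^^ n)))"

definition unimodular_eigenvectors :: "('a::complex_normed_vector \<Rightarrow> 'a) \<Rightarrow> 'a set" where
  "unimodular_eigenvectors T = (\<Union>l\<in>{z. cmod z = 1}. {x. l *\<^sub>C x - T x = 0}) - {0}"


section \<open>Families of sets of natural numbers\<close>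

definition syndetic_sets :: "nat set set" where
  "syndetic_sets = {A. \<exists>m\<ge>1. \<forall>x. {x..x + m} \<inter> A \<noteq> {}}"

definition IP_sets :: "nat set set" where
  "IP_sets = {A. \<exists>x::nat \<Rightarrow> nat. strict_mono x \<and> {\<Sum>n\<in>F. x n |F. finite F \<and> F \<noteq> {}} \<subseteq> A}"

definition Delta_sets :: "nat set set" where
  "Delta_sets = {A. \<exists>B. infinite B \<and> {a - b |a b. a \<in> B \<and> b \<in> B \<and> b < a} \<subseteq> A}"

definition dual_family :: "nat set set \<Rightarrow> nat set set" where
  "dual_family \<F> = {A. infinite A \<and> (\<forall>B\<in>\<F>. A \<inter> B \<noteq> {})}"


section \<open>Recurrence\<close>

definition return_set :: "('a \<Rightarrow> 'a) \<Rightarrow> 'a \<Rightarrow> 'a set \<Rightarrow> nat set" where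
  "return_set T x A = {n. (T ^^ n) x \<in> A}"

definition family_Rec :: "nat set set \<Rightarrow> ('a::topological_space \<Rightarrow> 'a) \<Rightarrow> 'a set" where
  "family_Rec \<F> T = {x. \<forall>U. x \<in> interior U \<longrightarrow> return_set T x U \<in> \<F>}"

abbreviation URec :: "('a::topological_space \<Rightarrow> 'a) \<Rightarrow> 'a set" where
  "URec \<equiv> family_Rec syndetic_sets"

abbreviation IP_star_Rec :: "('a::topological_space \<Rightarrow> 'a) \<Rightarrow> 'a set" where
  "IP_star_Rec \<equiv> family_Rec (dual_family IP_sets)"

abbreviation Delta_star_Rec :: "('a::topological_space \<Rightarrow> 'a) \<Rightarrow> 'a set" where
  "Delta_star_Rec \<equiv> family_Rec (dual_family Delta_sets)"

definition uniformly_recurrent :: "('a::topological_space \<Rightarrow> 'a) \<Rightarrow> bool" where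
  "uniformly_recurrent T \<longleftrightarrow> closure (URec T) = UNIV"

definition IP_star_recurrent :: "('a::topological_space \<Rightarrow> 'a) \<Rightarrow> bool" where
  "IP_star_recurrent T \<longleftrightarrow> closure (IP_star_Rec T) = UNIV"

definition Delta_star_recurrent :: "('a::topological_space \<Rightarrow> 'a) \<Rightarrow> bool" where
  "Delta_star_recurrent T \<longleftrightarrow> closure (Delta_star_Rec T) = UNIV"

end

theory Submission
  imports Defs
begin

text \<open>
  Everything follows from the chain of inclusions
  \<open>span E(T) \<subseteq> \<Delta>*Rec(T) \<subseteq> IP*Rec(T) \<subseteq> URec(T) \<subseteq> closure (span E(T))\<close>,
  where \<open>E(T)\<close> is the set of unimodular eigenvectors: all these sets have the same closure, and if
  one of them is contained in \<open>{0}\<close> then they all are.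

  The first inclusion comes from compactness of the circle. If \<open>x\<close> is a combination of finitely many
  eigenvectors, then every strictly increasing sequence of exponents has a subsequence along which the
  powers of all the eigenvalues converge; a late difference \<open>n\<close> of two terms of this subsequence has
  \<open>T^n x\<close> close to \<open>x\<close> (\<open>cspan_eigenvectors_subset_Delta_star_Rec\<close>). The next two inclusions are
  combinatorial: the differences of the partial sums of a sequence are finite sums of its terms, and a
  set with unboundedly long gaps leaves room for an IP-set in its complement
  (\<open>IP_sets_subset_Delta_sets\<close>, \<open>IP_set_in_complement_of_non_syndetic\<close>).

  The last inclusion is a Bochner--Fejer approximation carried out in the Banach space itself. Let
  \<open>x\<close> be uniformly recurrent.
  \<^item> Since \<open>x\<close> returns to itself with bounded gaps and the powers of \<open>T\<close> are uniformly bounded, the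
    orbit of \<open>x\<close> is totally bounded (\<open>compact_orbit_closure\<close>).
  \<^item> The averages \<open>v(z,L) = (1/L) \<Sum>n<L. z^n T^n x\<close> lie in the absolutely convex hull of the orbit,
    which is again totally bounded, and they satisfy \<open>z T v = v + O(1/L)\<close>. A limit point as \<open>L\<close>
    grows is thus zero or a unimodular eigenvector, so that for large \<open>L\<close> all the averages are close
    to \<open>E(T) \<union> {0}\<close>, uniformly in \<open>z\<close> (\<open>twisted_averages_near_eigenvectors\<close>).
  \<^item> Let \<open>D\<close> be the set of \<open>d < N\<close> for which \<open>T^d x\<close> is close to \<open>x\<close>, and let \<open>L = 2N\<close>. The mean of
    \<open>T^(d+d') x\<close> over \<open>d, d' \<in> D\<close> is still close to \<open>x\<close>. By Fourier inversion on the cyclic group of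
    order \<open>L\<close> it equals \<open>\<Sum>j<L. u_j^2 v(w_j,L)\<close>, where the \<open>w_j\<close> are the \<open>L\<close>-th roots of unity and
    \<open>u_j\<close> is the Fourier transform of the uniform distribution on \<open>D\<close>
    (\<open>fourier_synthesis_of_double_mean\<close>).
  \<^item> Replacing each \<open>v(w_j,L)\<close> by a vector of \<open>E(T) \<union> {0}\<close> at distance less than \<open>\<eta>\<close> costs at most
    \<open>\<eta> \<Sum>|u_j|^2 = \<eta> L / |D|\<close> by Parseval. Since \<open>D\<close> has gaps bounded by some \<open>m\<close> that is fixed before
    \<open>\<eta>\<close> and \<open>L\<close>, this is at most \<open>2 \<eta> (m + 1)\<close>. The result is a combination of unimodular eigenvectors
    close to \<open>x\<close>.
\<close>

section \<open>Complex scalars and bounded operators\<close>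

lemma bounded_bilinear_scaleC:
  "bounded_bilinear (scaleC :: complex \<Rightarrow> 'a \<Rightarrow> 'a::complex_normed_vector)"
proof
  show "\<exists>K. \<forall>a (b::'a). norm (a *\<^sub>C b) \<le> norm a * norm b * K"
    by (rule exI [of _ 1]) (simp add: norm_scaleC)
  fix r a and b :: 'a
  show "(r *\<^sub>R a) *\<^sub>C b = r *\<^sub>R (a *\<^sub>C b)"
    by (simp add: scaleR_conv_of_real flip: scaleC_scaleC scaleC_of_real)
  show "a *\<^sub>C (r *\<^sub>R b) = r *\<^sub>R (a *\<^sub>C b)"
    by (simp add: scaleC_scaleC mult.commute flip: scaleC_of_real)
qed (simp_all add: scaleC_add_right scaleC_add_left)

lemmas continuous_on_scaleC [continuous_intros] =
  bounded_bilinear.continuous_on [OF bounded_bilinear_scaleC]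

lemmas tendsto_scaleC [tendsto_intros] = bounded_bilinear.tendsto [OF bounded_bilinear_scaleC]

lemma bounded_linear_funpow:
  assumes "bounded_linear (T :: 'a::real_normed_vector \<Rightarrow> 'a)"
  shows "bounded_linear (T ^^ n)"
proof (induction n)
  case 0
  show ?case by (simp add: id_def)
next
  case (Suc n)
  show ?case
    using bounded_linear_compose [OF assms Suc] by (simp add: o_def)
qed

lemma bounded_clinear_funpow:
  assumes "bounded_clinear (T :: 'a::complex_normed_vector \<Rightarrow> 'a)"
  shows "bounded_clinear (T ^^ n)"
proof -
  have "(T ^^ n) (c *\<^sub>C x) = c *\<^sub>C (T ^^ n) x" for c x
    using assms by (induction n) (auto simp: bounded_clinear_def)
  with assms show ?thesis
    by (simp add: bounded_clinear_def bounded_linear_funpow)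
qed

lemma power_bounded_imp_bound:
  assumes "power_bounded T"
  obtains M where "M \<ge> 0" "\<And>n x. norm ((T ^^ n) x) \<le> M * norm x"
proof -
  from assms obtain M where M: "onorm (T ^^ n) \<le> M" for n
    by (auto simp: power_bounded_def bdd_above_def)
  from assms have lin: "bounded_linear (T ^^ n)" for n
    by (simp add: power_bounded_def bounded_clinear_def bounded_linear_funpow)
  show thesis
  proof
    show "0 \<le> M"
      using M [of 0] onorm_pos_le [OF lin [of 0]] by linarith
    show "norm ((T ^^ n) x) \<le> M * norm x" for n x
      using onorm [OF lin] M by (meson mult_right_mono norm_ge_zero order_trans)
  qed
qed


section \<open>Families of sets of natural numbers\<close>

text \<open>If the finite sums of \<open>x\<close> lie in \<open>A\<close>, then so do the differences of the partial sums of \<open>x\<close>,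
  because they are sums of \<open>x\<close> over intervals of indices.\<close>

lemma IP_sets_subset_Delta_sets: "IP_sets \<subseteq> Delta_sets"
proof
  fix A assume "A \<in> IP_sets"
  then obtain x :: "nat \<Rightarrow> nat"
    where x: "strict_mono x" and sub: "{\<Sum>n\<in>F. x n |F. finite F \<and> F \<noteq> {}} \<subseteq> A"
    by (auto simp: IP_sets_def)
  define b where "b n = (\<Sum>i\<le>n. x i)" for n
  \<comment> \<open>Only \<open>x 0\<close> can vanish, and every partial sum contains it.\<close>
  have "x (Suc n) > 0" for n
    using strict_monoD [OF x, of n "Suc n"] by simp
  then have b: "strict_mono b"
    by (simp add: strict_mono_Suc_iff b_def)
  have "b j - b i \<in> A" if "b i < b j" for i j
  proof -
    have ij: "i < j"
      using that b by (simp add: strict_mono_less)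
    have "b j = (\<Sum>k\<in>{..i} \<union> {i<..j}. x k)"
      unfolding b_def using ij by (intro sum.cong) auto
    also have "\<dots> = b i + (\<Sum>k\<in>{i<..j}. x k)"
      unfolding b_def by (rule sum.union_disjoint) auto
    finally have "b j - b i = (\<Sum>k\<in>{i<..j}. x k)"
      by simp
    moreover have "{i<..j} \<noteq> {}"
      using ij by auto
    ultimately show ?thesis
      using sub by blast
  qed
  then have "{a - c |a c. a \<in> range b \<and> c \<in> range b \<and> c < a} \<subseteq> A"
    by auto
  moreover have "infinite (range b)"
    using b strict_mono_imp_inj_on range_inj_infinite by blast
  ultimately show "A \<in> Delta_sets"
    unfolding Delta_sets_def by blast
qed

lemma dual_family_antimono: "\<F> \<subseteq> \<G> \<Longrightarrow> dual_family \<G> \<subseteq> dual_family \<F>"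
  by (auto simp: dual_family_def)

text \<open>Choose the generators one after the other. If the earlier ones sum to \<open>S\<close>, take a gap of
  \<open>A\<close> longer than \<open>2 S\<close> and place the next generator in its middle: adding any sum of earlier
  generators does not lead out of the gap, and the offset of more than \<open>S\<close> from the start of the gap
  makes the new generator larger than the earlier ones.\<close>

lemma IP_set_in_complement_of_non_syndetic:
  assumes "A \<notin> syndetic_sets"
  shows "- A \<in> IP_sets"
proof -
  have "\<exists>y. {y..y + m} \<inter> A = {}" if "m \<ge> 1" for m
    using assms that unfolding syndetic_sets_def by blast
  then obtain y where y: "{y m..y m + m} \<inter> A = {}" if "m \<ge> 1" for m
    by metis
  \<comment> \<open>\<open>S n\<close> is the sum of the first \<open>n\<close> generators.\<close>
  define S where "S = rec_nat 0 (\<lambda>_ s. s + (y (2 * s + 1) + s + 1))"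
  define x where "x n = y (2 * S n + 1) + S n + 1" for n
  have S_0: "S 0 = 0" and S_Suc: "S (Suc n) = S n + x n" for n
    by (simp_all add: S_def x_def)
  have S_sum: "S n = (\<Sum>i<n. x i)" for n
    by (induction n) (simp_all add: S_0 S_Suc)
  have mono: "strict_mono x"
    unfolding strict_mono_Suc_iff
  proof
    fix n
    show "x n < x (Suc n)"
      using S_Suc [of n] x_def [of "Suc n"] by linarith
  qed
  have "(\<Sum>n\<in>F. x n) \<in> - A" if F: "finite F" "F \<noteq> {}" for F
  proof -
    define k where "k = Max F"
    have k: "k \<in> F" "F - {k} \<subseteq> {..<k}"
      using F by (auto simp: k_def order.not_eq_order_implies_strict)
    have "(\<Sum>n\<in>F. x n) = x k + (\<Sum>n\<in>F - {k}. x n)"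
      using F k by (simp add: sum.remove)
    moreover have "(\<Sum>n\<in>F - {k}. x n) \<le> S k"
      unfolding S_sum using k by (intro sum_mono2) auto
    ultimately have "(\<Sum>n\<in>F. x n) \<in> {y (2 * S k + 1)..y (2 * S k + 1) + (2 * S k + 1)}"
      by (auto simp: x_def)
    with y [of "2 * S k + 1"] show ?thesis
      by auto
  qed
  then have "{\<Sum>n\<in>F. x n |F. finite F \<and> F \<noteq> {}} \<subseteq> - A"
    by blast
  with mono show ?thesis
    unfolding IP_sets_def by blast
qed

lemma dual_IP_subset_syndetic: "dual_family IP_sets \<subseteq> syndetic_sets"
proof
  fix A assume "A \<in> dual_family IP_sets"
  then show "A \<in> syndetic_sets"
    using IP_set_in_complement_of_non_syndetic [of A] by (auto simp: dual_family_def)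
qed

text \<open>A set that meets every \<open>\<Delta>\<close>-set is infinite, since the positive differences of
  the multiples of \<open>m + 1\<close> all exceed \<open>m\<close>.\<close>

lemma dual_DeltaI:
  assumes "\<And>B. B \<in> Delta_sets \<Longrightarrow> A \<inter> B \<noteq> {}"
  shows "A \<in> dual_family Delta_sets"
proof -
  have "\<exists>n>m. n \<in> A" for m
  proof -
    have "infinite (range (\<lambda>k. Suc m * k))"
      by (rule range_inj_infinite) (simp only: inj_on_def mult_cancel1, simp)
    moreover have "Suc m * k - Suc m * l > m" if "Suc m * l < Suc m * k" for k l
    proof -
      have "l < k"
        using that by (simp only: mult_less_cancel1)
      then have "Suc m * 1 \<le> Suc m * (k - l)"
        by (intro mult_le_mono2) simp
      then have "Suc m \<le> Suc m * (k - l)"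
        by (simp only: mult_1_right)
      then show ?thesis
        by (simp only: diff_mult_distrib2 Suc_le_eq)
    qed
    then have "{a - b |a b. a \<in> range (\<lambda>k. Suc m * k) \<and> b \<in> range (\<lambda>k. Suc m * k) \<and> b < a} \<subseteq> {m<..}"
      by blast
    ultimately have "{m<..} \<in> Delta_sets"
      unfolding Delta_sets_def by blast
    with assms show ?thesis
      by fastforce
  qed
  then have "infinite A"
    by (simp add: infinite_nat_iff_unbounded)
  with assms show ?thesis
    by (simp add: dual_family_def)
qed

lemma family_Rec_mono: "\<F> \<subseteq> \<G> \<Longrightarrow> family_Rec \<F> T \<subseteq> family_Rec \<G> T"
  by (auto simp: family_Rec_def)


section \<open>Combinations of unimodular eigenvectors\<close>

definition returns_along :: "('a::metric_space \<Rightarrow> 'a) \<Rightarrow> 'a \<Rightarrow> (nat \<Rightarrow> nat) \<Rightarrow> bool" where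
  "returns_along T x b \<longleftrightarrow>
     (\<forall>e>0. \<exists>N. \<forall>i\<ge>N. \<forall>j>i. dist ((T ^^ (b j - b i)) x) x < e)"

lemma returns_along_subseq:
  assumes "returns_along T x b" "strict_mono s"
  shows "returns_along T x (b \<circ> s)"
  unfolding returns_along_def
proof (intro allI impI)
  fix e :: real assume "e > 0"
  with assms(1) obtain N where N: "\<And>i j. i \<ge> N \<Longrightarrow> j > i \<Longrightarrow> dist ((T ^^ (b j - b i)) x) x < e"
    unfolding returns_along_def by metis
  have "dist ((T ^^ ((b \<circ> s) j - (b \<circ> s) i)) x) x < e" if "i \<ge> N" "j > i" for i j
    unfolding o_apply
  proof (rule N)
    show "s i \<ge> N"
      using seq_suble [OF assms(2), of i] that by simp
    show "s j > s i"
      using assms(2) that by (simp add: strict_mono_less)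
  qed
  then show "\<exists>N. \<forall>i\<ge>N. \<forall>j>i. dist ((T ^^ ((b \<circ> s) j - (b \<circ> s) i)) x) x < e"
    by blast
qed

text \<open>Returning along a common sequence is a linear condition on the vector.\<close>

lemma returns_along_add:
  assumes T: "bounded_clinear T" and x: "returns_along T x b" and y: "returns_along T y b"
  shows "returns_along T (x + y) b"
  unfolding returns_along_def
proof (intro allI impI)
  fix e :: real assume "e > 0"
  then have e: "e / 2 > 0" by simp
  from x e obtain N where N: "\<And>i j. i \<ge> N \<Longrightarrow> j > i \<Longrightarrow> dist ((T ^^ (b j - b i)) x) x < e / 2"
    unfolding returns_along_def by metis
  from y e obtain N' where N': "\<And>i j. i \<ge> N' \<Longrightarrow> j > i \<Longrightarrow> dist ((T ^^ (b j - b i)) y) y < e / 2"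
    unfolding returns_along_def by metis
  have "dist ((T ^^ (b j - b i)) (x + y)) (x + y) < e" if "i \<ge> max N N'" "j > i" for i j
  proof -
    have "(T ^^ n) (x + y) = (T ^^ n) x + (T ^^ n) y" for n
      using bounded_clinear_funpow [OF T] by (simp add: bounded_clinear_def linear_simps(1))
    then show ?thesis
      using dist_triangle_add [of "(T ^^ (b j - b i)) x" "(T ^^ (b j - b i)) y" x y]
        N [of i j] N' [of i j] that by simp
  qed
  then show "\<exists>N. \<forall>i\<ge>N. \<forall>j>i. dist ((T ^^ (b j - b i)) (x + y)) (x + y) < e"
    by blast
qed

lemma returns_along_scaleC:
  assumes T: "bounded_clinear T" and x: "returns_along T x b"
  shows "returns_along T (c *\<^sub>C x) b"
  unfolding returns_along_def
proof (intro allI impI)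
  fix e :: real assume "e > 0"
  have pos: "cmod c + 1 > 0"
    by (simp add: add_nonneg_pos)
  with \<open>e > 0\<close> have "e / (cmod c + 1) > 0" by simp
  with x obtain N where
    N: "\<And>i j. i \<ge> N \<Longrightarrow> j > i \<Longrightarrow> dist ((T ^^ (b j - b i)) x) x < e / (cmod c + 1)"
    unfolding returns_along_def by metis
  have "dist ((T ^^ (b j - b i)) (c *\<^sub>C x)) (c *\<^sub>C x) < e" if "i \<ge> N" "j > i" for i j
  proof -
    have "dist ((T ^^ (b j - b i)) (c *\<^sub>C x)) (c *\<^sub>C x) = cmod c * dist ((T ^^ (b j - b i)) x) x"
      using bounded_clinear_funpow [OF T]
      by (simp add: bounded_clinear_def dist_norm
          flip: norm_scaleC complex_vector.scale_right_diff_distrib)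
    also have "\<dots> \<le> (cmod c + 1) * dist ((T ^^ (b j - b i)) x) x"
      by (intro mult_right_mono) auto
    also have "\<dots> < e"
      using N [OF that] pos by (simp add: field_simps)
    finally show ?thesis .
  qed
  then show "\<exists>N. \<forall>i\<ge>N. \<forall>j>i. dist ((T ^^ (b j - b i)) (c *\<^sub>C x)) (c *\<^sub>C x) < e"
    by blast
qed

text \<open>Asking for returns along a subsequence of every given sequence makes the property stable under
  sums, by passing to a subsequence twice; \<open>\<Delta>*\<close>-recurrence alone is not visibly so.\<close>

definition subsequentially_returning :: "('a::metric_space \<Rightarrow> 'a) \<Rightarrow> 'a \<Rightarrow> bool" where
  "subsequentially_returning T x \<longleftrightarrow>
     (\<forall>b. strict_mono b \<longrightarrow> (\<exists>r::nat \<Rightarrow> nat. strict_mono r \<and> returns_along T x (b \<circ> r)))"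

lemma subsequentially_returning_imp_Delta_star_Rec:
  assumes "subsequentially_returning T x"
  shows "x \<in> Delta_star_Rec T"
  unfolding family_Rec_def
proof (intro CollectI allI impI dual_DeltaI)
  fix U B assume "x \<in> interior U" "B \<in> Delta_sets"
  then obtain e where e: "e > 0" "ball x e \<subseteq> U"
    using mem_interior by blast
  from \<open>B \<in> Delta_sets\<close> obtain C where "infinite C"
    and sub: "{a - b |a b. a \<in> C \<and> b \<in> C \<and> b < a} \<subseteq> B"
    by (auto simp: Delta_sets_def)
  then have c: "strict_mono (enumerate C)" "\<And>n. enumerate C n \<in> C"
    by (simp_all add: strict_mono_enumerate enumerate_in_set)
  with assms obtain r :: "nat \<Rightarrow> nat"
    where r: "strict_mono r" "returns_along T x (enumerate C \<circ> r)"
    unfolding subsequentially_returning_def by blast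
  from r(2) e(1) obtain N where
    N: "\<And>i j. i \<ge> N \<Longrightarrow> j > i \<Longrightarrow> dist ((T ^^ (enumerate C (r j) - enumerate C (r i))) x) x < e"
    unfolding returns_along_def o_apply by metis
  define d where "d = enumerate C (r (Suc N)) - enumerate C (r N)"
  have "dist ((T ^^ d) x) x < e"
    using N by (simp add: d_def)
  then have "d \<in> return_set T x U"
    using e(2) by (auto simp: return_set_def dist_commute)
  moreover have "enumerate C (r N) < enumerate C (r (Suc N))"
    using c(1) r(1) by (simp add: strict_mono_less)
  then have "d \<in> B"
    using sub c(2) unfolding d_def by blast
  ultimately show "return_set T x U \<inter> B \<noteq> {}"
    by blast
qed

lemma subsequentially_returning_eigenvector:
  assumes "bounded_clinear T" "T x = l *\<^sub>C x" "cmod l = 1"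
  shows "subsequentially_returning T x"
  unfolding subsequentially_returning_def
proof (intro allI impI)
  fix b :: "nat \<Rightarrow> nat" assume b: "strict_mono b"
  have pow: "(T ^^ n) x = l ^ n *\<^sub>C x" for n
    using assms by (induction n) (simp_all add: bounded_clinear_def scaleC_scaleC mult.commute)
  have "\<forall>n. l ^ b n \<in> sphere 0 1"
    using assms by (simp add: norm_power)
  then obtain z r where r: "strict_mono r" and lim: "((\<lambda>n. l ^ b n) \<circ> r) \<longlonglongrightarrow> z"
    using compact_sphere [of "0::complex" 1] unfolding compact_def by metis
  have "returns_along T x (b \<circ> r)"
    unfolding returns_along_def o_apply
  proof (intro allI impI)
    fix e :: real assume "e > 0"
    have pos: "norm x + 1 > 0"
      by (simp add: add_nonneg_pos)
    with \<open>e > 0\<close> have "e / (norm x + 1) > 0" by simp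
    with LIMSEQ_imp_Cauchy [OF lim] obtain N where
      N: "\<And>i j. i \<ge> N \<Longrightarrow> j \<ge> N \<Longrightarrow> dist (l ^ b (r j)) (l ^ b (r i)) < e / (norm x + 1)"
      unfolding Cauchy_def o_def by meson
    have "dist ((T ^^ (b (r j) - b (r i))) x) x < e" if "i \<ge> N" "j > i" for i j
    proof -
      have le: "b (r i) \<le> b (r j)"
        using b r that(2) by (simp add: strict_mono_less_eq)
      \<comment> \<open>Multiplication by the unimodular number \<open>l ^ b (r i)\<close> turns the difference of exponents into
        a difference of terms of a Cauchy sequence.\<close>
      have "cmod (l ^ (b (r j) - b (r i)) - 1) = cmod (l ^ b (r i) * (l ^ (b (r j) - b (r i)) - 1))"
        using assms by (simp add: norm_mult norm_power)
      also have "\<dots> = dist (l ^ b (r j)) (l ^ b (r i))"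
        using le by (simp add: dist_norm right_diff_distrib flip: power_add)
      also have "\<dots> < e / (norm x + 1)"
        using N that by simp
      finally have *: "cmod (l ^ (b (r j) - b (r i)) - 1) < e / (norm x + 1)" .
      have "dist ((T ^^ (b (r j) - b (r i))) x) x = cmod (l ^ (b (r j) - b (r i)) - 1) * norm x"
        by (simp add: dist_norm pow complex_vector.scale_left_diff_distrib flip: norm_scaleC)
      also have "\<dots> \<le> cmod (l ^ (b (r j) - b (r i)) - 1) * (norm x + 1)"
        by (intro mult_left_mono) auto
      also have "\<dots> < e"
        using * pos by (simp add: field_simps)
      finally show ?thesis .
    qed
    then show "\<exists>N. \<forall>i\<ge>N. \<forall>j>i. dist ((T ^^ (b (r j) - b (r i))) x) x < e"
      by blast
  qed
  with r show "\<exists>r::nat \<Rightarrow> nat. strict_mono r \<and> returns_along T x (b \<circ> r)"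
    by blast
qed

lemma subsequentially_returning_add:
  assumes T: "bounded_clinear T"
    and x: "subsequentially_returning T x" and y: "subsequentially_returning T y"
  shows "subsequentially_returning T (x + y)"
  unfolding subsequentially_returning_def
proof (intro allI impI)
  fix b :: "nat \<Rightarrow> nat" assume b: "strict_mono b"
  with x obtain r :: "nat \<Rightarrow> nat" where r: "strict_mono r" "returns_along T x (b \<circ> r)"
    unfolding subsequentially_returning_def by blast
  have "strict_mono (b \<circ> r)"
    using b r(1) by (rule strict_mono_o)
  with y obtain s :: "nat \<Rightarrow> nat" where s: "strict_mono s" "returns_along T y (b \<circ> r \<circ> s)"
    unfolding subsequentially_returning_def by blast
  have "returns_along T (x + y) (b \<circ> r \<circ> s)"
    using T returns_along_subseq [OF r(2) s(1)] s(2) by (rule returns_along_add)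
  with strict_mono_o [OF r(1) s(1)]
  show "\<exists>r::nat \<Rightarrow> nat. strict_mono r \<and> returns_along T (x + y) (b \<circ> r)"
    unfolding comp_assoc by blast
qed

lemma cspan_eigenvectors_subset_Delta_star_Rec:
  assumes T: "bounded_clinear T"
  shows "cspan (unimodular_eigenvectors T) \<subseteq> Delta_star_Rec T"
proof -
  have "(T ^^ n) 0 = 0" for n
    using bounded_clinear_funpow [OF T] by (simp add: bounded_clinear_def linear_simps)
  then have "subsequentially_returning T 0"
    by (auto simp: subsequentially_returning_def returns_along_def intro!: exI [of _ id] strict_monoI)
  moreover have "subsequentially_returning T (c *\<^sub>C x)" if "subsequentially_returning T x" for c x
    using that returns_along_scaleC [OF T] unfolding subsequentially_returning_def by blast
  ultimately have "complex_vector.subspace {x. subsequentially_returning T x}"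
    using T by (simp add: complex_vector.subspace_def subsequentially_returning_add)
  moreover have "unimodular_eigenvectors T \<subseteq> {x. subsequentially_returning T x}"
    by (auto simp: unimodular_eigenvectors_def intro: subsequentially_returning_eigenvector [OF T sym])
  ultimately show ?thesis
    using complex_vector.span_minimal subsequentially_returning_imp_Delta_star_Rec by blast
qed


section \<open>Compactness of absolutely convex hulls\<close>

lemma compact_closure_if_near_compact:
  fixes S :: "'a::complete_space set"
  assumes "\<And>e. e > 0 \<Longrightarrow> \<exists>C. compact C \<and> (\<forall>x\<in>S. \<exists>c\<in>C. dist c x < e)"
  shows "compact (closure S)"
  unfolding compact_eq_totally_bounded
proof (intro conjI allI impI)
  show "complete (closure S)"
    by (simp add: complete_eq_closed)
  fix e :: real assume "e > 0"
  then have e: "e / 3 > 0" by simp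
  from assms [OF e] obtain C where C: "compact C" "\<And>x. x \<in> S \<Longrightarrow> \<exists>c\<in>C. dist c x < e / 3"
    by blast
  with e obtain K where K: "finite K" "C \<subseteq> (\<Union>k\<in>K. ball k (e / 3))"
    unfolding compact_eq_totally_bounded by blast
  have "closure S \<subseteq> (\<Union>k\<in>K. ball k e)"
  proof
    fix x assume "x \<in> closure S"
    with e obtain y where y: "y \<in> S" "dist y x < e / 3"
      by (meson closure_approachable)
    with C obtain c where c: "c \<in> C" "dist c y < e / 3" by blast
    with K obtain k where k: "k \<in> K" "dist k c < e / 3" by auto
    have "dist k x < e"
      using dist_triangle [of k x c] dist_triangle [of c x y] y c k by linarith
    with k show "x \<in> (\<Union>k\<in>K. ball k e)" by auto
  qed
  with K show "\<exists>K. finite K \<and> closure S \<subseteq> (\<Union>k\<in>K. ball k e)" by blast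
qed

text \<open>Adding one vector \<open>a\<close> to \<open>K\<close> replaces the set by its sum with the compact disc spanned by
  \<open>a\<close>.\<close>

lemma compact_bounded_combinations:
  fixes K :: "'a::complex_normed_vector set"
  assumes "finite K"
  shows "compact {\<Sum>k\<in>K. c k *\<^sub>C k |c. \<forall>k. cmod (c k) \<le> 1}"
  using assms
proof (induction K rule: finite_induct)
  case empty
  have "{\<Sum>k\<in>{}. c k *\<^sub>C k |c. \<forall>k::'a. cmod (c k) \<le> 1} = {0}"
    by (auto intro!: exI [of _ "\<lambda>_. 0"])
  then show ?case by simp
next
  case (insert a K)
  let ?C = "\<lambda>K. {\<Sum>k\<in>K. c k *\<^sub>C k |c. \<forall>k. cmod (c k) \<le> 1}"
  have "?C (insert a K) = (\<lambda>(z, y). z *\<^sub>C a + y) ` (cball 0 1 \<times> ?C K)"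
  proof (intro equalityI subsetI)
    fix x assume "x \<in> ?C (insert a K)"
    then obtain c where "x = (\<Sum>k\<in>insert a K. c k *\<^sub>C k)" "\<forall>k. cmod (c k) \<le> 1"
      by blast
    then show "x \<in> (\<lambda>(z, y). z *\<^sub>C a + y) ` (cball 0 1 \<times> ?C K)"
      using insert.hyps by (intro image_eqI [of _ _ "(c a, \<Sum>k\<in>K. c k *\<^sub>C k)"]) auto
  next
    fix x assume "x \<in> (\<lambda>(z, y). z *\<^sub>C a + y) ` (cball 0 1 \<times> ?C K)"
    then obtain z c where x: "x = z *\<^sub>C a + (\<Sum>k\<in>K. c k *\<^sub>C k)" "cmod z \<le> 1" "\<forall>k. cmod (c k) \<le> 1"
      by auto
    have "(\<Sum>k\<in>K. (c(a := z)) k *\<^sub>C k) = (\<Sum>k\<in>K. c k *\<^sub>C k)"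
      using insert.hyps by (intro sum.cong) auto
    with x insert.hyps show "x \<in> ?C (insert a K)"
      by (intro CollectI exI [of _ "c(a := z)"]) simp
  qed
  moreover have "compact \<dots>"
    using insert.IH unfolding case_prod_beta
    by (intro compact_continuous_image continuous_intros compact_Times) auto
  ultimately show ?case by simp
qed

definition absolutely_convex_hull :: "'a::complex_normed_vector set \<Rightarrow> 'a set" where
  "absolutely_convex_hull S =
     {\<Sum>i\<in>I. c i *\<^sub>C y i |(I::nat set) c y. finite I \<and> y ` I \<subseteq> S \<and> (\<Sum>i\<in>I. cmod (c i)) \<le> 1}"

text \<open>Replacing the points of \<open>S\<close> by nearby points of a finite set \<open>K\<close> moves an absolutely convex
  combination only slightly, and the resulting combinations of \<open>K\<close> lie in a compact set.\<close>

lemma compact_absolutely_convex_hull: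
  fixes S :: "'a::complex_banach set"
  assumes "compact (closure S)"
  shows "compact (closure (absolutely_convex_hull S))"
proof (rule compact_closure_if_near_compact)
  fix e :: real assume "e > 0"
  then have e2: "e / 2 > 0" by simp
  with assms obtain K where K: "finite K" "closure S \<subseteq> (\<Union>k\<in>K. ball k (e / 2))"
    unfolding compact_eq_totally_bounded by blast
  then have "\<forall>y\<in>S. \<exists>k\<in>K. dist k y < e / 2"
    using closure_subset [of S] by fastforce
  then obtain p where p: "\<And>y. y \<in> S \<Longrightarrow> p y \<in> K \<and> dist (p y) y < e / 2"
    by metis
  show "\<exists>C. compact C \<and> (\<forall>x\<in>absolutely_convex_hull S. \<exists>c\<in>C. dist c x < e)"
  proof (intro exI conjI ballI)
    show "compact {\<Sum>k\<in>K. c k *\<^sub>C k |c. \<forall>k. cmod (c k) \<le> 1}"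
      using K by (intro compact_bounded_combinations)
    fix x assume "x \<in> absolutely_convex_hull S"
    then obtain I :: "nat set" and c y where x: "x = (\<Sum>i\<in>I. c i *\<^sub>C y i)"
      and I: "finite I" "y ` I \<subseteq> S" "(\<Sum>i\<in>I. cmod (c i)) \<le> 1"
      by (auto simp: absolutely_convex_hull_def)
    define d where "d k = (\<Sum>i\<in>{i\<in>I. p (y i) = k}. c i)" for k
    have d: "cmod (d k) \<le> 1" for k
    proof -
      have "cmod (d k) \<le> (\<Sum>i\<in>{i\<in>I. p (y i) = k}. cmod (c i))"
        unfolding d_def by (rule norm_sum)
      also have "\<dots> \<le> (\<Sum>i\<in>I. cmod (c i))"
        using I by (intro sum_mono2) auto
      finally show ?thesis using I by linarith
    qed
    have "(\<Sum>k\<in>K. d k *\<^sub>C k) = (\<Sum>k\<in>K. \<Sum>i\<in>{i\<in>I. p (y i) = k}. c i *\<^sub>C p (y i))"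
      unfolding d_def complex_vector.scale_sum_left by (intro sum.cong) auto
    also have "\<dots> = (\<Sum>i\<in>I. c i *\<^sub>C p (y i))"
      using I K p by (intro sum.group) auto
    finally have "dist (\<Sum>k\<in>K. d k *\<^sub>C k) x = norm (\<Sum>i\<in>I. c i *\<^sub>C (p (y i) - y i))"
      by (simp add: x dist_norm complex_vector.scale_right_diff_distrib sum_subtractf)
    also have "\<dots> \<le> (\<Sum>i\<in>I. cmod (c i) * (e / 2))"
    proof (rule sum_norm_le)
      fix i assume "i \<in> I"
      then have "dist (p (y i)) (y i) < e / 2"
        using I p by blast
      then show "norm (c i *\<^sub>C (p (y i) - y i)) \<le> cmod (c i) * (e / 2)"
        unfolding norm_scaleC dist_norm by (intro mult_left_mono) auto
    qed
    also have "\<dots> = (\<Sum>i\<in>I. cmod (c i)) * (e / 2)"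
      by (simp add: sum_distrib_right)
    also have "\<dots> \<le> 1 * (e / 2)"
      using I e2 by (intro mult_right_mono) auto
    also have "\<dots> < e"
      using \<open>e > 0\<close> by simp
    finally have "dist (\<Sum>k\<in>K. d k *\<^sub>C k) x < e" .
    with d show "\<exists>c\<in>{\<Sum>k\<in>K. c k *\<^sub>C k |c. \<forall>k. cmod (c k) \<le> 1}. dist c x < e"
      by blast
  qed
qed


section \<open>Twisted ergodic averages\<close>

definition twisted_average ::
    "('a::complex_normed_vector \<Rightarrow> 'a) \<Rightarrow> 'a \<Rightarrow> complex \<Rightarrow> nat \<Rightarrow> 'a" where
  "twisted_average T x z L = (\<Sum>n<L. (z ^ n / of_nat L) *\<^sub>C (T ^^ n) x)"

lemma twisted_average_in_absolutely_convex_hull: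
  assumes "cmod z = 1"
  shows "twisted_average T x z L \<in> absolutely_convex_hull (range (\<lambda>n. (T ^^ n) x))"
  unfolding absolutely_convex_hull_def twisted_average_def
  by (intro CollectI exI [of _ "{..<L}"] exI [of _ "\<lambda>n. z ^ n / of_nat L"] exI [of _ "\<lambda>n. (T ^^ n) x"])
    (auto simp: norm_divide norm_power assms)

text \<open>Applying \<open>z T\<close> shifts the index of summation by one, so that only the two boundary terms
  survive in the difference.\<close>

lemma twisted_average_almost_eigenvector:
  assumes T: "bounded_clinear T" and z: "cmod z = 1" and B: "\<And>n. norm ((T ^^ n) x) \<le> B"
  shows "norm (z *\<^sub>C T (twisted_average T x z L) - twisted_average T x z L) \<le> 2 * B / real L"
proof -
  let ?f = "\<lambda>n. (z ^ n / of_nat L) *\<^sub>C (T ^^ n) x"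
  have "z *\<^sub>C T (twisted_average T x z L) = (\<Sum>n<L. ?f (Suc n))"
    using T by (simp add: twisted_average_def bounded_clinear_def bounded_linear.linear linear_sum
        complex_vector.scale_sum_right scaleC_scaleC)
  then have "z *\<^sub>C T (twisted_average T x z L) - twisted_average T x z L = (\<Sum>n<L. ?f (Suc n) - ?f n)"
    by (simp only: twisted_average_def sum_subtractf)
  also have "\<dots> = ?f L - ?f 0"
    by (rule sum_lessThan_telescope)
  also have "norm \<dots> \<le> norm (?f L) + norm (?f 0)"
    by (rule norm_triangle_ineq4)
  also have "\<dots> \<le> B / real L + B / real L"
    using B [of L] B [of 0] z
    by (intro add_mono) (simp_all add: norm_scaleC norm_divide norm_power divide_right_mono)
  finally show ?thesis by simp
qed

text \<open>Otherwise there are averages of growing length, with varying \<open>z\<close>, that stay away from the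
  eigenvectors and from zero. By compactness of the circle and of the closed absolutely convex hull of
  the orbit, a subsequence of the pairs (number, average) converges to some \<open>(w, y)\<close>, and
  \<open>w T y = y\<close>.\<close>

lemma twisted_averages_near_eigenvectors:
  fixes T :: "'a::complex_banach \<Rightarrow> 'a"
  assumes T: "bounded_clinear T" and orb: "compact (closure (range (\<lambda>n. (T ^^ n) x)))"
    and "e > 0"
  shows "\<exists>L0. \<forall>L\<ge>L0. \<forall>z. cmod z = 1 \<longrightarrow>
    (\<exists>y\<in>insert 0 (unimodular_eigenvectors T). dist (twisted_average T x z L) y < e)"
proof (rule ccontr)
  assume "\<not> ?thesis"
  then have "\<forall>k. \<exists>L z. L \<ge> k \<and> cmod z = 1 \<and>
      (\<forall>y\<in>insert 0 (unimodular_eigenvectors T). \<not> dist (twisted_average T x z L) y < e)"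
    by blast
  then obtain L z where "\<forall>k. L k \<ge> k \<and> cmod (z k) = 1 \<and>
      (\<forall>y\<in>insert 0 (unimodular_eigenvectors T). \<not> dist (twisted_average T x (z k) (L k)) y < e)"
    by (subst (asm) choice_iff, subst (asm) choice_iff) blast
  then have L: "\<And>k. L k \<ge> k" and z: "\<And>k. cmod (z k) = 1"
    and far: "\<And>k y. y \<in> insert 0 (unimodular_eigenvectors T) \<Longrightarrow>
      \<not> dist (twisted_average T x (z k) (L k)) y < e"
    by blast+
  define v where "v k = twisted_average T x (z k) (L k)" for k
  let ?H = "closure (absolutely_convex_hull (range (\<lambda>n. (T ^^ n) x)))"
  have "compact (sphere (0::complex) 1 \<times> ?H)"
    using orb by (intro compact_Times compact_sphere compact_absolutely_convex_hull)
  moreover have "\<forall>k. (z k, v k) \<in> sphere 0 1 \<times> ?H"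
    using z twisted_average_in_absolutely_convex_hull closure_subset
    by (fastforce simp: v_def)
  ultimately obtain p r where p: "p \<in> sphere 0 1 \<times> ?H" and r: "strict_mono r"
    and lim: "((\<lambda>k. (z k, v k)) \<circ> r) \<longlonglongrightarrow> p"
    by (rule seq_compactE [OF compact_imp_seq_compact])
  define w y where "w = fst p" and "y = snd p"
  from lim have z_lim: "(\<lambda>k. z (r k)) \<longlonglongrightarrow> w" and v_lim: "(\<lambda>k. v (r k)) \<longlonglongrightarrow> y"
    using tendsto_fst [OF lim] tendsto_snd [OF lim] by (simp_all add: o_def w_def y_def)
  have "bounded (range (\<lambda>n. (T ^^ n) x))"
    using compact_imp_bounded [OF orb] closure_subset by (rule bounded_subset)
  then obtain B where B: "\<And>n. norm ((T ^^ n) x) \<le> B"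
    by (auto simp: bounded_iff)
  have B0: "0 \<le> B"
    using B [of 0] norm_ge_zero order_trans by blast
  have "(\<lambda>k. T (v (r k))) \<longlonglongrightarrow> T y"
    using T v_lim by (auto simp: bounded_clinear_def intro: bounded_linear.tendsto)
  then have "(\<lambda>k. z (r k) *\<^sub>C T (v (r k)) - v (r k)) \<longlonglongrightarrow> w *\<^sub>C T y - y"
    using z_lim v_lim by (intro tendsto_intros)
  moreover have "(\<lambda>k. z (r k) *\<^sub>C T (v (r k)) - v (r k)) \<longlonglongrightarrow> 0"
  proof (rule Lim_null_comparison)
    show "(\<lambda>k. 2 * B / real k) \<longlonglongrightarrow> 0"
      by (rule lim_const_over_n)
    have "norm (z (r k) *\<^sub>C T (v (r k)) - v (r k)) \<le> 2 * B / real k" if "k > 0" for k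
    proof -
      have "k \<le> L (r k)"
        using seq_suble [OF r, of k] L [of "r k"] by linarith
      then have "2 * B / real (L (r k)) \<le> 2 * B / real k"
        using that B0 by (intro divide_left_mono) auto
      then show ?thesis
        using twisted_average_almost_eigenvector [OF T z B, of "r k" "L (r k)"]
        by (simp add: v_def)
    qed
    then show "\<forall>\<^sub>F k in sequentially. norm (z (r k) *\<^sub>C T (v (r k)) - v (r k)) \<le> 2 * B / real k"
      using eventually_gt_at_top [of 0] by (rule eventually_mono [rotated])
  qed
  ultimately have eq: "w *\<^sub>C T y = y"
    using LIMSEQ_unique by fastforce
  have w: "cmod w = 1"
    using p by (auto simp: w_def)
  have "cnj w *\<^sub>C y = cnj w *\<^sub>C w *\<^sub>C T y"
    using eq by simp
  also have "\<dots> = T y"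
    using w complex_norm_square [of w] by (simp add: scaleC_scaleC mult.commute)
  finally have "y \<in> insert 0 (unimodular_eigenvectors T)"
    using w by (auto simp: unimodular_eigenvectors_def intro!: exI [of _ "cnj w"])
  moreover obtain k where "dist (v (r k)) y < e"
    using v_lim \<open>e > 0\<close> unfolding lim_sequentially by blast
  ultimately show False
    using far by (auto simp: v_def)
qed


section \<open>Fourier analysis on a finite cyclic group\<close>

definition unity_root :: "nat \<Rightarrow> nat \<Rightarrow> complex" where
  "unity_root L k = cis (2 * pi * real k / real L)"

lemma norm_unity_root [simp]: "cmod (unity_root L k) = 1"
  by (simp add: unity_root_def)

lemma unity_root_power_commute: "unity_root L j ^ k = unity_root L k ^ j"
  by (simp add: unity_root_def Complex.DeMoivre field_simps)

lemma unity_root_orthogonality: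
  assumes "p < L" "n < L"
  shows "(\<Sum>j<L. unity_root L j ^ p * cnj (unity_root L j) ^ n) = (if p = n then of_nat L else 0)"
proof -
  let ?q = "unity_root L p * cnj (unity_root L n)"
  have cnj: "cnj (unity_root L j) ^ n = cnj (unity_root L n) ^ j" for j
    by (metis complex_cnj_power unity_root_power_commute)
  have unit: "unity_root L k * cnj (unity_root L k) = 1" for k
    using complex_norm_square [of "unity_root L k"] by simp
  have "(\<Sum>j<L. unity_root L j ^ p * cnj (unity_root L j) ^ n) = (\<Sum>j<L. ?q ^ j)"
    by (simp add: power_mult_distrib cnj unity_root_power_commute [of L _ p])
  also have "\<dots> = (if p = n then of_nat L else 0)"
  proof (cases "p = n")
    case True
    then show ?thesis by (simp add: unit)
  next
    case False
    have roots: "bij_betw (unity_root L) {..<L} {z. z ^ L = 1}"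
      using Complex.bij_betw_roots_unity [of L] assms by (simp add: unity_root_def [abs_def])
    then have "unity_root L p \<noteq> unity_root L n"
      using assms False by (auto simp: bij_betw_def inj_on_def)
    have "?q \<noteq> 1"
    proof
      assume "?q = 1"
      then have "unity_root L p * (cnj (unity_root L n) * unity_root L n) = unity_root L n"
        by (simp flip: mult.assoc)
      then show False
        using \<open>unity_root L p \<noteq> unity_root L n\<close> unit [of n] by (simp add: mult.commute)
    qed
    moreover have "unity_root L k ^ L = 1" if "k < L" for k
      using roots that by (auto simp: bij_betw_def)
    then have "?q ^ L = 1"
      using assms by (simp add: power_mult_distrib flip: complex_cnj_power)
    ultimately show ?thesis
      using False by (simp add: geometric_sum)
  qed
  finally show ?thesis .
qed

text \<open>The Fourier transform, at the \<open>j\<close>-th character of the cyclic group of order \<open>L\<close>, of the uniform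
  distribution on \<open>D\<close>.\<close>

definition fourier_mean :: "nat set \<Rightarrow> nat \<Rightarrow> nat \<Rightarrow> complex" where
  "fourier_mean D L j = (\<Sum>d\<in>D. unity_root L j ^ d) / of_nat (card D)"

lemma parseval_fourier_mean:
  assumes D: "finite D" "D \<noteq> {}" "D \<subseteq> {..<L}"
  shows "(\<Sum>j<L. (cmod (fourier_mean D L j))\<^sup>2) = real L / real (card D)"
proof -
  have c: "card D \<noteq> 0"
    using D by simp
  have "complex_of_real (\<Sum>j<L. (cmod (fourier_mean D L j))\<^sup>2) =
      (\<Sum>j<L. \<Sum>d\<in>D. \<Sum>d'\<in>D. unity_root L j ^ d * cnj (unity_root L j) ^ d') / (of_nat (card D))\<^sup>2"
    unfolding of_real_sum complex_norm_square fourier_mean_def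
    by (simp add: sum_product power2_eq_square flip: sum_divide_distrib)
  also have "(\<Sum>j<L. \<Sum>d\<in>D. \<Sum>d'\<in>D. unity_root L j ^ d * cnj (unity_root L j) ^ d') =
      (\<Sum>d\<in>D. \<Sum>d'\<in>D. \<Sum>j<L. unity_root L j ^ d * cnj (unity_root L j) ^ d')"
    by (simp add: sum.swap [of _ D "{..<L}"])
  also have "\<dots> = (\<Sum>d\<in>D. \<Sum>d'\<in>D. if d = d' then of_nat L else 0)"
    using D by (intro sum.cong refl unity_root_orthogonality) auto
  also have "\<dots> = of_nat (card D) * of_nat L"
    using D by simp
  finally have "complex_of_real (\<Sum>j<L. (cmod (fourier_mean D L j))\<^sup>2) =
      complex_of_real (real L / real (card D))"
    using c by (simp add: power2_eq_square)
  then show ?thesis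
    by (simp only: of_real_eq_iff)
qed

text \<open>The square of \<open>fourier_mean\<close> is the transform of the distribution of \<open>d + d'\<close> with \<open>d\<close> and \<open>d'\<close>
  uniform in \<open>D\<close>, and the averages twisted by the conjugate characters are the Fourier coefficients of
  the orbit. Hence this is Fourier inversion. The group has order \<open>2 N\<close>, so that the sums \<open>d + d'\<close> do
  not wrap around.\<close>

lemma fourier_synthesis_of_double_mean:
  fixes T :: "'a::complex_normed_vector \<Rightarrow> 'a"
  assumes "D \<subseteq> {..<N}"
  shows "(\<Sum>j<2 * N. (fourier_mean D (2 * N) j)\<^sup>2 *\<^sub>C twisted_average T x (cnj (unity_root (2 * N) j)) (2 * N)) =
    (1 / (of_nat (card D))\<^sup>2) *\<^sub>C (\<Sum>d\<in>D. \<Sum>d'\<in>D. (T ^^ (d + d')) x)"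
proof -
  define L where "L = 2 * N"
  define a where "a j d n = unity_root L j ^ d * cnj (unity_root L j) ^ n" for j d n
  define C where "C = (1 / (of_nat (card D))\<^sup>2 :: complex)"
  have "(fourier_mean D L j)\<^sup>2 *\<^sub>C twisted_average T x (cnj (unity_root L j)) L =
      C *\<^sub>C (\<Sum>d\<in>D. \<Sum>d'\<in>D. \<Sum>n<L. (a j (d + d') n / of_nat L) *\<^sub>C (T ^^ n) x)" for j
  proof -
    have "(fourier_mean D L j)\<^sup>2 = C * (\<Sum>d\<in>D. \<Sum>d'\<in>D. unity_root L j ^ (d + d'))"
      by (simp add: fourier_mean_def power2_eq_square sum_product C_def power_add)
    then have "(fourier_mean D L j)\<^sup>2 *\<^sub>C twisted_average T x (cnj (unity_root L j)) L =
        C *\<^sub>C (\<Sum>d\<in>D. \<Sum>d'\<in>D. unity_root L j ^ (d + d') *\<^sub>C twisted_average T x (cnj (unity_root L j)) L)"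
      by (simp only: complex_vector.scale_sum_left flip: scaleC_scaleC)
    then show ?thesis
      by (simp add: twisted_average_def a_def complex_vector.scale_sum_right scaleC_scaleC)
  qed
  then have "(\<Sum>j<L. (fourier_mean D L j)\<^sup>2 *\<^sub>C twisted_average T x (cnj (unity_root L j)) L) =
      C *\<^sub>C (\<Sum>j<L. \<Sum>d\<in>D. \<Sum>d'\<in>D. \<Sum>n<L. (a j (d + d') n / of_nat L) *\<^sub>C (T ^^ n) x)"
    by (simp add: complex_vector.scale_sum_right)
  also have "(\<Sum>j<L. \<Sum>d\<in>D. \<Sum>d'\<in>D. \<Sum>n<L. (a j (d + d') n / of_nat L) *\<^sub>C (T ^^ n) x) =
      (\<Sum>d\<in>D. \<Sum>d'\<in>D. \<Sum>j<L. \<Sum>n<L. (a j (d + d') n / of_nat L) *\<^sub>C (T ^^ n) x)"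
    by (simp only: sum.swap [of _ D "{..<L}"])
  also have "\<dots> = (\<Sum>d\<in>D. \<Sum>d'\<in>D. (T ^^ (d + d')) x)"
  proof (intro sum.cong refl)
    fix d d' assume "d \<in> D" "d' \<in> D"
    then have "d < N" "d' < N"
      using assms by auto
    then have lt: "d + d' < L"
      by (simp add: L_def)
    have "(\<Sum>j<L. \<Sum>n<L. (a j (d + d') n / of_nat L) *\<^sub>C (T ^^ n) x) =
        (\<Sum>n<L. ((\<Sum>j<L. a j (d + d') n) / of_nat L) *\<^sub>C (T ^^ n) x)"
      by (subst sum.swap) (simp add: complex_vector.scale_sum_left sum_divide_distrib)
    also have "\<dots> = (\<Sum>n<L. if d + d' = n then (T ^^ n) x else 0)"
      using lt by (intro sum.cong refl) (simp add: a_def unity_root_orthogonality)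
    also have "\<dots> = (T ^^ (d + d')) x"
      using lt by simp
    finally show "(\<Sum>j<L. \<Sum>n<L. (a j (d + d') n / of_nat L) *\<^sub>C (T ^^ n) x) = (T ^^ (d + d')) x" .
  qed
  finally show ?thesis
    by (simp add: L_def C_def)
qed


section \<open>Uniformly recurrent vectors\<close>

lemma URec_return_times:
  fixes T :: "'a::metric_space \<Rightarrow> 'a"
  assumes "x \<in> URec T" "e > 0"
  shows "\<exists>m. \<forall>t. \<exists>d\<in>{t..t + m}. dist ((T ^^ d) x) x < e"
proof -
  have "return_set T x (ball x e) \<in> syndetic_sets"
    using assms by (simp add: family_Rec_def interior_open)
  then obtain m where "\<forall>t. {t..t + m} \<inter> return_set T x (ball x e) \<noteq> {}"
    by (auto simp: syndetic_sets_def)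
  then show ?thesis
    by (intro exI [of _ m]) (fastforce simp: return_set_def dist_commute)
qed

text \<open>If \<open>m\<close> bounds the gaps between the times \<open>d\<close> at which \<open>T^d x\<close> is close to \<open>x\<close>, then every
  \<open>n\<close> is \<open>d + k\<close> with such a \<open>d\<close> and with \<open>k \<le> m\<close>, and \<open>T^n x\<close> is close to \<open>T^k x\<close> by power
  boundedness. So the first \<open>m + 1\<close> points of the orbit are a net for it.\<close>

lemma compact_orbit_closure:
  fixes T :: "'a::complex_banach \<Rightarrow> 'a"
  assumes T: "power_bounded T" and x: "x \<in> URec T"
  shows "compact (closure (range (\<lambda>n. (T ^^ n) x)))"
proof (rule compact_closure_if_near_compact)
  fix e :: real assume "e > 0"
  obtain M where M: "M \<ge> 0" "\<And>n y. norm ((T ^^ n) y) \<le> M * norm y"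
    using power_bounded_imp_bound [OF T] by blast
  have "e / (M + 1) > 0"
    using \<open>e > 0\<close> M by simp
  from URec_return_times [OF x this] obtain m where
    m: "\<And>t. \<exists>d\<in>{t..t + m}. dist ((T ^^ d) x) x < e / (M + 1)" by blast
  have "\<exists>k\<le>m. dist ((T ^^ k) x) ((T ^^ n) x) < e" for n
  proof (cases "n \<le> m")
    case True
    with \<open>e > 0\<close> show ?thesis by (intro exI [of _ n]) simp
  next
    case False
    from m [of "n - m"] obtain d where d: "d \<in> {n - m..n}" "dist ((T ^^ d) x) x < e / (M + 1)"
      using False by auto
    have "(T ^^ n) x = (T ^^ (n - d)) ((T ^^ d) x)"
      using d by (simp flip: funpow_add [THEN fun_cong, unfolded o_apply])
    moreover have "(T ^^ (n - d)) ((T ^^ d) x - x) = (T ^^ (n - d)) ((T ^^ d) x) - (T ^^ (n - d)) x"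
      using T by (simp add: power_bounded_def bounded_clinear_def bounded_linear_funpow linear_simps)
    ultimately have "dist ((T ^^ (n - d)) x) ((T ^^ n) x) = norm ((T ^^ (n - d)) ((T ^^ d) x - x))"
      by (simp add: dist_norm norm_minus_commute)
    also have "\<dots> \<le> M * norm ((T ^^ d) x - x)"
      by (rule M)
    also have "\<dots> \<le> M * (e / (M + 1))"
      using d M by (intro mult_left_mono) (auto simp: dist_norm)
    also have "\<dots> < e"
      using \<open>e > 0\<close> M by (simp add: field_simps)
    finally show ?thesis
      using d by (intro exI [of _ "n - d"]) auto
  qed
  then show "\<exists>C. compact C \<and> (\<forall>y\<in>range (\<lambda>n. (T ^^ n) x). \<exists>c\<in>C. dist c y < e)"
    by (intro exI [of _ "(\<lambda>k. (T ^^ k) x) ` {..m}"]) (auto simp: finite_imp_compact)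
qed

lemma card_of_bounded_gaps:
  fixes D :: "nat set"
  assumes "\<And>t. \<exists>d\<in>{t..t + m}. d \<in> D"
  shows "q \<le> card (D \<inter> {..<q * (m + 1)})"
proof -
  obtain f where f: "\<And>t. f t \<in> {t..t + m}" "\<And>t. f t \<in> D"
    using assms by metis
  define g where "g i = f (i * (m + 1))" for i
  have div: "g i div (m + 1) = i" for i
    using f(1) [of "i * (m + 1)"] unfolding g_def by (intro div_nat_eqI) (auto simp: algebra_simps)
  then have "inj_on g {..<q}"
    by (metis inj_onI)
  moreover have "g ` {..<q} \<subseteq> D \<inter> {..<q * (m + 1)}"
  proof clarify
    fix i assume "i < q"
    moreover have "g i div (m + 1) < q \<longleftrightarrow> g i < q * (m + 1)"
      by (rule div_less_iff_less_mult) simp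
    ultimately have "g i < q * (m + 1)"
      by (simp only: div)
    then show "g i \<in> D \<inter> {..<q * (m + 1)}"
      using f(2) by (simp add: g_def)
  qed
  ultimately show ?thesis
    using card_inj_on_le [of g "{..<q}"] by force
qed

lemma norm_scaled_double_sum_le:
  fixes f :: "'b \<Rightarrow> 'b \<Rightarrow> 'a::complex_normed_vector"
  assumes "finite D" "D \<noteq> {}" "\<And>d d'. d \<in> D \<Longrightarrow> d' \<in> D \<Longrightarrow> dist (f d d') x \<le> e"
  shows "dist ((1 / (of_nat (card D))\<^sup>2) *\<^sub>C (\<Sum>d\<in>D. \<Sum>d'\<in>D. f d d')) x \<le> e"
proof -
  define c where "c = real (card D)"
  have c: "c > 0"
    using assms by (simp add: c_def card_gt_0_iff)
  have scale: "(1 / (of_nat (card D))\<^sup>2) *\<^sub>C y = (1 / c\<^sup>2) *\<^sub>R y" for y :: 'a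
    by (simp add: c_def flip: scaleC_of_real)
  have "(1 / c\<^sup>2) *\<^sub>R (\<Sum>d\<in>D. \<Sum>d'\<in>D. f d d') - x = (1 / c\<^sup>2) *\<^sub>R (\<Sum>d\<in>D. \<Sum>d'\<in>D. f d d' - x)"
    using c by (simp add: sum_subtractf scaleR_diff_right sum_constant_scaleR power2_eq_square
        flip: c_def)
  also have "norm \<dots> \<le> (1 / c\<^sup>2) * (\<Sum>d\<in>D. \<Sum>d'\<in>D. e)"
    using assms(3) unfolding norm_scaleR
    by (intro mult_mono sum_norm_le) (auto simp: dist_norm)
  also have "\<dots> = e"
    using c by (simp add: power2_eq_square flip: c_def)
  finally show ?thesis
    by (simp add: scale dist_norm)
qed

text \<open>The vector \<open>S'\<close> below is the mean of \<open>T^(d+d') x\<close> over pairs of return times, written as a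
  combination of twisted averages, and \<open>S\<close> is the same combination of nearby vectors that are eigenvectors or zero. The squares
  of the coefficients \<open>u j\<close> are what makes this work: Parseval bounds the sum of their absolute values
  independently of the length \<open>L\<close> of the averages, whereas a single mean over \<open>D\<close> would have the
  coefficients \<open>u j\<close>, for which Cauchy--Schwarz only gives a bound of order \<open>sqrt L\<close>.\<close>

lemma URec_subset_closure_cspan_eigenvectors:
  fixes T :: "'a::complex_banach \<Rightarrow> 'a"
  assumes T: "power_bounded T"
  shows "URec T \<subseteq> closure (cspan (unimodular_eigenvectors T))"
proof
  fix x assume x: "x \<in> URec T"
  have lin: "bounded_clinear T"
    using T by (simp add: power_bounded_def)
  obtain M where M: "M \<ge> 0" "\<And>n y. norm ((T ^^ n) y) \<le> M * norm y"
    using power_bounded_imp_bound [OF T] by blast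
  show "x \<in> closure (cspan (unimodular_eigenvectors T))"
    unfolding closure_approachable
  proof (intro allI impI)
    fix e :: real assume "e > 0"
    define \<delta> where "\<delta> = e / (2 * (M + 1))"
    have "\<delta> > 0"
      using \<open>e > 0\<close> M by (simp add: \<delta>_def)
    from URec_return_times [OF x this] obtain m where
      m: "\<And>t. \<exists>d\<in>{t..t + m}. dist ((T ^^ d) x) x < \<delta>" by blast
    \<comment> \<open>Passing to eigenvectors will cost at most \<open>2 (m + 1) \<eta> = e / 4\<close>; the choice is possible since \<open>m\<close> is already fixed.\<close>
    define \<eta> where "\<eta> = e / (8 * real (m + 1))"
    have "\<eta> > 0"
      using \<open>e > 0\<close> by (simp add: \<eta>_def)
    with twisted_averages_near_eigenvectors [OF lin compact_orbit_closure [OF T x]]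
    obtain q where q: "\<And>L z. L \<ge> q \<Longrightarrow> cmod z = 1 \<Longrightarrow>
        \<exists>y\<in>insert 0 (unimodular_eigenvectors T). dist (twisted_average T x z L) y < \<eta>"
      by blast
    \<comment> \<open>\<open>N\<close> is a multiple of \<open>m + 1\<close>, so that \<open>D\<close> has at least \<open>N / (m + 1) = Suc q\<close> elements.\<close>
    define N where "N = Suc q * (m + 1)"
    define L where "L = 2 * N"
    define D where "D = {d. dist ((T ^^ d) x) x < \<delta>} \<inter> {..<N}"
    have card: "Suc q \<le> card D"
      unfolding D_def N_def by (rule card_of_bounded_gaps) (use m in blast)
    have D: "finite D" "D \<noteq> {}" "D \<subseteq> {..<N}" "D \<subseteq> {..<L}"
      using card by (auto simp: D_def L_def)
    have "L \<ge> q"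
      by (simp add: L_def N_def)
    then have "\<exists>y\<in>insert 0 (unimodular_eigenvectors T).
        dist (twisted_average T x (cnj (unity_root L j)) L) y < \<eta>" for j
      by (intro q) simp_all
    then obtain y where y: "\<And>j. y j \<in> insert 0 (unimodular_eigenvectors T)"
      "\<And>j. dist (twisted_average T x (cnj (unity_root L j)) L) (y j) < \<eta>"
      by metis
    define u where "u = fourier_mean D L"
    define S where "S = (\<Sum>j<L. (u j)\<^sup>2 *\<^sub>C y j)"
    define S' where "S' = (\<Sum>j<L. (u j)\<^sup>2 *\<^sub>C twisted_average T x (cnj (unity_root L j)) L)"
    have "S \<in> cspan (unimodular_eigenvectors T)"
      unfolding S_def using y(1)
      by (intro complex_vector.span_sum complex_vector.span_scale)
        (metis complex_vector.span_base complex_vector.span_zero insertE)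
    moreover have "dist S' x \<le> e / 2"
    proof -
      have "dist ((T ^^ (d + d')) x) x \<le> e / 2" if "d \<in> D" "d' \<in> D" for d d'
      proof -
        have "(T ^^ (d + d')) x - (T ^^ d) x = (T ^^ d) ((T ^^ d') x - x)"
          using lin by (simp add: bounded_clinear_def bounded_linear_funpow linear_simps funpow_add)
        then have "dist ((T ^^ (d + d')) x) ((T ^^ d) x) \<le> M * norm ((T ^^ d') x - x)"
          using M by (simp add: dist_norm)
        also have "\<dots> \<le> M * \<delta>"
          using that M by (intro mult_left_mono) (auto simp: D_def dist_norm)
        finally have "dist ((T ^^ (d + d')) x) ((T ^^ d) x) \<le> M * \<delta>" .
        moreover have "dist ((T ^^ d) x) x \<le> \<delta>"
          using that by (simp add: D_def)
        ultimately have "dist ((T ^^ (d + d')) x) x \<le> (M + 1) * \<delta>"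
          using dist_triangle [of "(T ^^ (d + d')) x" x "(T ^^ d) x"] by (simp add: algebra_simps)
        also have "\<dots> = e / 2"
          using M by (simp add: \<delta>_def field_simps)
        finally show ?thesis .
      qed
      then show ?thesis
        using norm_scaled_double_sum_le [OF D(1,2), of "\<lambda>d d'. (T ^^ (d + d')) x" x "e / 2"]
          fourier_synthesis_of_double_mean [OF D(3), of T x]
        by (simp add: S'_def L_def u_def)
    qed
    moreover have "dist S S' < e / 2"
    proof -
      have "dist S S' = norm (\<Sum>j<L. (u j)\<^sup>2 *\<^sub>C (y j - twisted_average T x (cnj (unity_root L j)) L))"
        by (simp add: S_def S'_def dist_norm sum_subtractf complex_vector.scale_right_diff_distrib)
      also have "\<dots> \<le> (\<Sum>j<L. (cmod (u j))\<^sup>2 * \<eta>)"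
      proof (rule sum_norm_le)
        fix j
        have "norm (y j - twisted_average T x (cnj (unity_root L j)) L) \<le> \<eta>"
          using y(2) [of j] by (simp add: dist_norm norm_minus_commute)
        then show "norm ((u j)\<^sup>2 *\<^sub>C (y j - twisted_average T x (cnj (unity_root L j)) L))
            \<le> (cmod (u j))\<^sup>2 * \<eta>"
          unfolding norm_scaleC norm_power by (intro mult_left_mono) auto
      qed
      also have "\<dots> = real L / real (card D) * \<eta>"
        using parseval_fourier_mean [OF D(1,2,4)] by (simp add: u_def flip: sum_distrib_right)
      also have "\<dots> \<le> real L / real (Suc q) * \<eta>"
        using card \<open>\<eta> > 0\<close> by (intro mult_right_mono divide_left_mono) auto
      also have "\<dots> = 2 * real (m + 1) * \<eta>"
        by (simp add: L_def N_def field_simps)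
      also have "\<dots> = e / 4"
        by (simp add: \<eta>_def field_simps)
      finally show ?thesis
        using \<open>e > 0\<close> by simp
    qed
    ultimately have "dist S x < e"
      using dist_triangle [of S x S'] by linarith
    with \<open>S \<in> _\<close> show "\<exists>y\<in>cspan (unimodular_eigenvectors T). dist y x < e"
      by blast
  qed
qed

theorem theorem1p9:
  fixes T :: "'a::complex_banach \<Rightarrow> 'a"
  assumes "reflexive_space TYPE('a)"
    and "power_bounded T"
  shows "closure (cspan (unimodular_eigenvectors T)) = closure (URec T) \<and>
    ((unimodular_eigenvectors T \<noteq> {} \<longleftrightarrow> Delta_star_Rec T - {0} \<noteq> {}) \<and>
     (Delta_star_Rec T - {0} \<noteq> {} \<longleftrightarrow> IP_star_Rec T - {0} \<noteq> {}) \<and>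
     (IP_star_Rec T - {0} \<noteq> {} \<longleftrightarrow> URec T - {0} \<noteq> {})) \<and>
    ((closure (cspan (unimodular_eigenvectors T)) = UNIV \<longleftrightarrow> Delta_star_recurrent T) \<and>
     (Delta_star_recurrent T \<longleftrightarrow> IP_star_recurrent T) \<and>
     (IP_star_recurrent T \<longleftrightarrow> uniformly_recurrent T))"
proof -
  let ?E = "unimodular_eigenvectors T"
  have span_Delta: "cspan ?E \<subseteq> Delta_star_Rec T"
    using assms(2) by (intro cspan_eigenvectors_subset_Delta_star_Rec) (simp add: power_bounded_def)
  have Delta_IP: "Delta_star_Rec T \<subseteq> IP_star_Rec T"
    by (intro family_Rec_mono dual_family_antimono IP_sets_subset_Delta_sets)
  have IP_U: "IP_star_Rec T \<subseteq> URec T"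
    by (intro family_Rec_mono dual_IP_subset_syndetic)
  have U_span: "URec T \<subseteq> closure (cspan ?E)"
    using assms(2) by (rule URec_subset_closure_cspan_eigenvectors)
  have closures: "closure S = closure (cspan ?E)" if "cspan ?E \<subseteq> S" "S \<subseteq> URec T" for S
  proof
    show "closure S \<subseteq> closure (cspan ?E)"
      using that(2) U_span by (intro closure_minimal) auto
    show "closure (cspan ?E) \<subseteq> closure S"
      using that(1) by (rule closure_mono)
  qed
  have eq: "closure (Delta_star_Rec T) = closure (cspan ?E)"
    "closure (IP_star_Rec T) = closure (cspan ?E)" "closure (URec T) = closure (cspan ?E)"
    using span_Delta Delta_IP IP_U by (intro closures; blast)+
  have "?E \<subseteq> Delta_star_Rec T - {0}"
    using span_Delta complex_vector.span_superset [of ?E] by (auto simp: unimodular_eigenvectors_def)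
  moreover have "URec T - {0} = {}" if "?E = {}"
    using U_span that by auto
  ultimately have
    "?E \<noteq> {} \<longleftrightarrow> Delta_star_Rec T - {0} \<noteq> {}"
    "Delta_star_Rec T - {0} \<noteq> {} \<longleftrightarrow> IP_star_Rec T - {0} \<noteq> {}"
    "IP_star_Rec T - {0} \<noteq> {} \<longleftrightarrow> URec T - {0} \<noteq> {}"
    using Delta_IP IP_U by blast+
  with eq show ?thesis
    unfolding Delta_star_recurrent_def IP_star_recurrent_def uniformly_recurrent_def
    by simp
qed

end
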